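(* Let $p_n$, $d_n$ and $b_n$ denote respectively the number of 2sip-walks, deque-walks and big-walks of length $2n$ (defined in the context). Then the limits \[\mu_p=\lim_{n\to\infty}\sqrt[n]{p_n},\qquad \mu_d=\lim_{n\to\infty}\sqrt[n]{d_n},\qquad \mu_b=\lim_{n\to\infty}\sqrt[n]{b_n}\] exist, are finite, and are all equal. Equivalently, the exponential growth rate of the number of permutations of length $n$ sortable by a deque equals that of permutations of length $n$ sortable by two stacks in parallel.
   Context: All walks are finite sequences of unit steps from $\{N,E,S,W\}=\{(0,1),(1,0),(0,-1),(-1,0)\}$ on $\mathbb{Z}^2$, starting at $(0,0)$. A walk is \emph{eager} if it contains no two consecutive steps $E$ then $S$, and no two consecutive steps $N$ then $W$. A \emph{QP-subloop} of a walk is a contiguous subsequence of steps starting and ending at the same point $(p,q)$ and visiting only points $(x,y)$ with $x\ge p$, $y\ge q$. A walk is \emph{standard} if every QP-subloop (of positive length) begins with an $N$ step. A walk is \emph{vertical-happy} if every step starting from a point on the line $x+y=0$ or $x+y=1$ is $N$ or $S$. A \emph{big-walk} is a standard eager walk staying in the half-plane $\{x+y\ge 0\}$ and ending at some point $(x,-x)$. A \emph{deque-walk} is a vertical-happy big-walk. A \emph{2sip-walk} is a standard eager walk staying in the quarter-plane $\{x\ge0,y\ge0\}$ and ending at $(0,0)$. Known fact (not part of the claim to prove, but explaining the equivalent formulation): 2sip-walks of length $2n$ are in bijection with permutations of length $n$ sortable by two stacks in parallel, and deque-walks of length $2n$ are in bijection with permutations of length $n$ sortable by a double-ended queue. *)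

theory Defs
  imports Complex_Main
begin

datatype step = N | E | S | W

fun delta :: "step \<Rightarrow> int \<times> int" where
  "delta N = (0, 1)" | "delta E = (1, 0)" | "delta S = (0, -1)" | "delta W = (-1, 0)"

definition pt :: "step list \<Rightarrow> nat \<Rightarrow> int \<times> int" where
  "pt w i = ((\<Sum>k<i. fst (delta (w ! k))), (\<Sum>k<i. snd (delta (w ! k))))"

definition eager :: "step list \<Rightarrow> bool" where
  "eager w \<longleftrightarrow> (\<forall>i. Suc i < length w \<longrightarrow>
      \<not> (w ! i = E \<and> w ! Suc i = S) \<and> \<not> (w ! i = N \<and> w ! Suc i = W))"

definition qp_subloop :: "step list \<Rightarrow> nat \<Rightarrow> nat \<Rightarrow> bool" where
  "qp_subloop w i j \<longleftrightarrow> i < j \<and> j \<le> length w \<and> pt w i = pt w j \<and>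
     (\<forall>k. i \<le> k \<and> k \<le> j \<longrightarrow>
        fst (pt w k) \<ge> fst (pt w i) \<and> snd (pt w k) \<ge> snd (pt w i))"

definition standard :: "step list \<Rightarrow> bool" where
  "standard w \<longleftrightarrow> (\<forall>i j. qp_subloop w i j \<longrightarrow> w ! i = N)"

definition vertical_happy :: "step list \<Rightarrow> bool" where
  "vertical_happy w \<longleftrightarrow> (\<forall>i < length w.
      (fst (pt w i) + snd (pt w i) = 0 \<or> fst (pt w i) + snd (pt w i) = 1)
        \<longrightarrow> w ! i = N \<or> w ! i = S)"

definition big_walk :: "step list \<Rightarrow> bool" where
  "big_walk w \<longleftrightarrow> standard w \<and> eager w \<and>
     (\<forall>i \<le> length w. fst (pt w i) + snd (pt w i) \<ge> 0) \<and>
     fst (pt w (length w)) + snd (pt w (length w)) = 0"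

definition deque_walk :: "step list \<Rightarrow> bool" where
  "deque_walk w \<longleftrightarrow> vertical_happy w \<and> big_walk w"

definition twosip_walk :: "step list \<Rightarrow> bool" where
  "twosip_walk w \<longleftrightarrow> standard w \<and> eager w \<and>
     (\<forall>i \<le> length w. fst (pt w i) \<ge> 0 \<and> snd (pt w i) \<ge> 0) \<and>
     pt w (length w) = (0, 0)"

definition p_count :: "nat \<Rightarrow> nat" where
  "p_count n = card {w. length w = 2 * n \<and> twosip_walk w}"

definition d_count :: "nat \<Rightarrow> nat" where
  "d_count n = card {w. length w = 2 * n \<and> deque_walk w}"

definition b_count :: "nat \<Rightarrow> nat" where
  "b_count n = card {w. length w = 2 * n \<and> big_walk w}"

end

theory Submission
  imports Defs
begin

text \<open>All three classes are closed under concatenation, so Fekete's lemma gives the limits, and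
  both 2sip-walks and deque-walks are big-walks. Conversely, if \<open>w\<close> is a big-walk then
  \<open>NNwSS\<close> is a deque-walk, so \<open>b\<^sub>n \<le> d\<^sub>n\<^sub>+\<^sub>2\<close>.
  To compare big-walks with 2sip-walks, reflect in the diagonal all steps that lie in no
  QP-subloop: this is an involution on big-walks that negates the final abscissa. Concatenating
  big-walks ending at the most popular end point \<open>(x,-x)\<close> with big-walks ending at
  \<open>(-x,x)\<close> shows that closed big-walks have the same growth rate as all big-walks.
  Finally, \<open>m\<close> closed big-walks of a fixed length \<open>L\<close> stay in a square around
  the origin of size independent of \<open>m\<close>, and their concatenation \<open>w\<close> becomes
  the 2sip-walk \<open>N\<^sup>LE\<^sup>LwS\<^sup>LW\<^sup>L\<close>.\<close>

section \<open>Walks and concatenation\<close>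

abbreviation height :: "step list \<Rightarrow> nat \<Rightarrow> int" where
  "height w k \<equiv> fst (pt w k) + snd (pt w k)"

lemma pt_0 [simp]: "pt w 0 = (0, 0)"
  by (simp add: pt_def)

lemma fst_pt_Suc: "fst (pt w (Suc k)) = fst (pt w k) + fst (delta (w ! k))"
  and snd_pt_Suc: "snd (pt w (Suc k)) = snd (pt w k) + snd (delta (w ! k))"
  by (simp_all add: pt_def)

lemma fst_pt_Cons [simp]: "fst (pt (s # v) (Suc k)) = fst (delta s) + fst (pt v k)"
  and snd_pt_Cons [simp]: "snd (pt (s # v) (Suc k)) = snd (delta s) + snd (pt v k)"
  by (induction k) (simp_all add: fst_pt_Suc snd_pt_Suc)

lemma pt_append_left [simp]: "k \<le> length u \<Longrightarrow> pt (u @ v) k = pt u k"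
  by (simp add: pt_def nth_append)

lemma fst_pt_append_right [simp]:
    "fst (pt (u @ v) (length u + k)) = fst (pt u (length u)) + fst (pt v k)"
  and snd_pt_append_right [simp]:
    "snd (pt (u @ v) (length u + k)) = snd (pt u (length u)) + snd (pt v k)"
  by (induction k) (simp_all add: fst_pt_Suc snd_pt_Suc)

lemma fst_pt_append_end:
    "fst (pt (u @ v) (length (u @ v))) = fst (pt u (length u)) + fst (pt v (length v))"
  and snd_pt_append_end:
    "snd (pt (u @ v) (length (u @ v))) = snd (pt u (length u)) + snd (pt v (length v))"
  by simp_all

text \<open>The junction point is assigned to case \<open>left\<close>. The condition
  \<open>j > 0\<close> in case \<open>right\<close> matters for \<open>twosip_walk_border\<close>,
  where it puts points strictly below a given level.\<close>

lemma pt_append_cases: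
  assumes "k \<le> length (u @ v)"
  obtains (left) "k \<le> length u" "pt (u @ v) k = pt u k"
  | (right) j where "k = length u + j" "j > 0" "j \<le> length v"
      "fst (pt (u @ v) k) = fst (pt u (length u)) + fst (pt v j)"
      "snd (pt (u @ v) k) = snd (pt u (length u)) + snd (pt v j)"
proof (cases "k \<le> length u")
  case True
  then show ?thesis using left by simp
next
  case False
  then obtain j where "k = length u + j" "j > 0"
    by (metis less_imp_add_positive not_le)
  then show ?thesis using right assms by simp
qed

lemma abs_pt_le: "\<bar>fst (pt w k)\<bar> \<le> int k \<and> \<bar>snd (pt w k)\<bar> \<le> int k"
proof (induction k)
  case (Suc k)
  then show ?case
    by (cases "w ! k") (auto simp: fst_pt_Suc snd_pt_Suc)
qed simp

section \<open>QP-subloops and standardness under concatenation\<close>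

lemma qp_subloopD:
  assumes "qp_subloop w i j"
  shows "i < j" "j \<le> length w" "fst (pt w j) = fst (pt w i)" "snd (pt w j) = snd (pt w i)"
    and "\<And>k. i \<le> k \<Longrightarrow> k \<le> j \<Longrightarrow> fst (pt w i) \<le> fst (pt w k)"
    and "\<And>k. i \<le> k \<Longrightarrow> k \<le> j \<Longrightarrow> snd (pt w i) \<le> snd (pt w k)"
  using assms by (auto simp: qp_subloop_def)

lemma qp_subloopI:
  assumes "i < j" "j \<le> length w" "fst (pt w j) = fst (pt w i)" "snd (pt w j) = snd (pt w i)"
    and "\<And>k. i \<le> k \<Longrightarrow> k \<le> j \<Longrightarrow>
           fst (pt w i) \<le> fst (pt w k) \<and> snd (pt w i) \<le> snd (pt w k)"
  shows "qp_subloop w i j"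
  using assms by (auto simp: qp_subloop_def prod_eq_iff)

lemma qp_subloop_left:
  assumes "qp_subloop (u @ v) i j" "j \<le> length u"
  shows "qp_subloop u i j"
proof (rule qp_subloopI)
  note D = qp_subloopD[OF assms(1)]
  show "i < j" "j \<le> length u" using D(1) assms(2) by auto
  show "fst (pt u j) = fst (pt u i)" "snd (pt u j) = snd (pt u i)"
    using D(1,3,4) assms(2) by auto
  show "fst (pt u i) \<le> fst (pt u k) \<and> snd (pt u i) \<le> snd (pt u k)" if "i \<le> k" "k \<le> j" for k
    using D(5,6)[OF that] that assms(2) by auto
qed

lemma qp_subloop_right:
  assumes "qp_subloop (u @ v) (length u + i) (length u + j)"
  shows "qp_subloop v i j"
proof (rule qp_subloopI)
  note D = qp_subloopD[OF assms(1)]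
  show "i < j" "j \<le> length v" using D(1,2) by auto
  show "fst (pt v j) = fst (pt v i)" "snd (pt v j) = snd (pt v i)"
    using D(3,4) by auto
  show "fst (pt v i) \<le> fst (pt v k) \<and> snd (pt v i) \<le> snd (pt v k)" if "i \<le> k" "k \<le> j" for k
    using D(5,6)[of "length u + k"] that by auto
qed

lemma qp_subloop_Cons:
  assumes "qp_subloop (s # v) (Suc i) (Suc j)"
  shows "qp_subloop v i j"
  using qp_subloop_right[of "[s]" v i j] assms by simp

text \<open>A loop that crosses the junction has a base point bounding the junction point from below
  in both coordinates. Since the end of \<open>u\<close> has minimal height in \<open>u\<close>, the
  two points coincide, so the portion inside \<open>u\<close> is already a loop with the same first
  step.\<close>

lemma standard_append:
  assumes "standard u" "standard v"
    and min: "\<And>i. i \<le> length u \<Longrightarrow> height u (length u) \<le> height u i"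
  shows "standard (u @ v)"
  unfolding standard_def
proof (intro allI impI)
  fix i j assume l: "qp_subloop (u @ v) i j"
  note D = qp_subloopD[OF l]
  consider "j \<le> length u" | "length u \<le> i" | "i < length u" "length u < j" by linarith
  then show "(u @ v) ! i = N"
  proof cases
    case 1
    then have "qp_subloop u i j" using l qp_subloop_left by blast
    then show ?thesis using assms(1) 1 D(1) by (auto simp: standard_def nth_append)
  next
    case 2
    then obtain a where a: "i = length u + a" using le_Suc_ex by blast
    obtain b where "j = length u + b" using 2 D(1) le_Suc_ex[of "length u" j] by auto
    then have "qp_subloop v a b" using l a qp_subloop_right by blast
    then show ?thesis using assms(2) a by (auto simp: standard_def)
  next
    case 3
    have ge: "fst (pt u i) \<le> fst (pt u k)" "snd (pt u i) \<le> snd (pt u k)"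
      if "i \<le> k" "k \<le> length u" for k
      using D(5,6)[of k] that 3 by auto
    have "qp_subloop u i (length u)"
      using ge[of "length u"] ge min[of i] 3 by (intro qp_subloopI) (simp, simp, linarith+, blast)
    then show ?thesis using assms(1) 3 by (auto simp: standard_def nth_append)
  qed
qed

lemma standard_Cons:
  assumes "standard v" "\<And>j. qp_subloop (s # v) 0 j \<Longrightarrow> s = N"
  shows "standard (s # v)"
  unfolding standard_def
proof (intro allI impI)
  fix i j assume l: "qp_subloop (s # v) i j"
  show "(s # v) ! i = N"
  proof (cases i)
    case 0
    then show ?thesis using assms(2) l by simp
  next
    case (Suc a)
    then obtain b where "j = Suc b" using qp_subloopD(1)[OF l] by (cases j) auto
    then have "qp_subloop v a b" using l Suc qp_subloop_Cons by blast
    then show ?thesis using assms(1) Suc by (auto simp: standard_def)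
  qed
qed

lemma standard_Nil: "standard []"
  by (auto simp: standard_def qp_subloop_def)

lemma standard_Cons_N: "standard v \<Longrightarrow> standard (N # v)"
  by (rule standard_Cons) simp_all

text \<open>A first step S or W leaves the quadrant above the starting point at once, so no loop
  starts there.\<close>

lemma standard_Cons_SW:
  assumes "standard v" "s = S \<or> s = W"
  shows "standard (s # v)"
proof (rule standard_Cons[OF assms(1)])
  fix j assume l: "qp_subloop (s # v) 0 j"
  then show "s = N"
    using qp_subloopD(1)[OF l] qp_subloopD(5,6)[OF l, of "Suc 0"] assms(2) by auto
qed

lemma eager_append:
  assumes "eager u" "eager v"
    and "u = [] \<or> v = [] \<or> (last u, hd v) \<notin> {(E, S), (N, W)}"
  shows "eager (u @ v)"
  unfolding eager_def
proof (intro allI impI)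
  fix i assume i: "Suc i < length (u @ v)"
  consider "Suc i < length u" | "Suc i = length u" | "length u \<le> i" by linarith
  then show "\<not> ((u @ v) ! i = E \<and> (u @ v) ! Suc i = S) \<and>
             \<not> ((u @ v) ! i = N \<and> (u @ v) ! Suc i = W)"
  proof cases
    case 1
    then show ?thesis using assms(1) by (simp add: eager_def nth_append)
  next
    case 2
    then have ne: "u \<noteq> []" "v \<noteq> []" using i by auto
    have "(u @ v) ! i = last u" "(u @ v) ! Suc i = hd v"
      using 2 ne by (simp_all add: nth_append last_conv_nth hd_conv_nth flip: 2)
    then show ?thesis using assms(3) ne by auto
  next
    case 3
    then obtain a where "i = length u + a" using le_Suc_ex by blast
    then show ?thesis using assms(2) i by (auto simp: eager_def nth_append)
  qed
qed

lemma eager_replicate: "eager (replicate n s)"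
  by (auto simp: eager_def)

section \<open>Big-walks\<close>

text \<open>From height 0, a step S or W would leave the half-plane. Both forbidden pairs end in S
  or W, so placing a big-walk after any eager walk creates no forbidden pair at the
  junction.\<close>

lemma big_walk_hd:
  assumes "big_walk w" "w \<noteq> []"
  shows "hd w \<in> {N, E}"
proof -
  obtain s v where w: "w = s # v" using assms(2) by (cases w) auto
  have "height w (Suc 0) \<ge> 0" using assms w by (auto simp: big_walk_def)
  then show ?thesis using w by (cases s) auto
qed

lemma big_walk_last:
  assumes "big_walk w" "w \<noteq> []"
  shows "last w \<in> {S, W}"
proof -
  obtain k where k: "length w = Suc k" using assms(2) by (cases w) auto
  have "height w k \<ge> 0" "height w (Suc k) = 0" using assms k by (auto simp: big_walk_def)
  then have "fst (delta (w ! k)) + snd (delta (w ! k)) \<le> 0"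
    by (simp add: fst_pt_Suc snd_pt_Suc)
  then show ?thesis using k assms(2) by (cases "w ! k") (auto simp: last_conv_nth)
qed

lemma big_walk_min:
  assumes "big_walk w" "i \<le> length w"
  shows "height w (length w) \<le> height w i"
  using assms by (auto simp: big_walk_def)

lemma big_walk_append:
  assumes "big_walk u" "big_walk v"
  shows "big_walk (u @ v)"
  unfolding big_walk_def
proof (intro conjI allI impI)
  show "standard (u @ v)"
    using assms big_walk_min by (intro standard_append) (auto simp: big_walk_def)
  show "eager (u @ v)"
    using assms big_walk_hd[of v] big_walk_def by (intro eager_append) auto
  fix i assume "i \<le> length (u @ v)"
  then show "height (u @ v) i \<ge> 0"
    by (cases rule: pt_append_cases) (use assms in \<open>auto simp: big_walk_def\<close>)
next
  show "height (u @ v) (length (u @ v)) = 0"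
    using assms by (simp add: big_walk_def)
qed

lemma vertical_happy_append:
  assumes "vertical_happy u" "vertical_happy v" "height u (length u) = 0"
  shows "vertical_happy (u @ v)"
  unfolding vertical_happy_def
proof (intro allI impI)
  fix i assume i: "i < length (u @ v)" and h: "height (u @ v) i = 0 \<or> height (u @ v) i = 1"
  show "(u @ v) ! i = N \<or> (u @ v) ! i = S"
  proof (cases "i < length u")
    case True
    then show ?thesis using assms(1) h by (auto simp: vertical_happy_def nth_append)
  next
    case False
    then obtain a where a: "i = length u + a" by (metis le_Suc_ex not_less)
    then have "height v a = 0 \<or> height v a = 1" using h assms(3) by (simp, linarith)
    then show ?thesis using assms(2) i a by (auto simp: vertical_happy_def)
  qed
qed

lemma deque_walk_append: "deque_walk u \<Longrightarrow> deque_walk v \<Longrightarrow> deque_walk (u @ v)"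
  using big_walk_append vertical_happy_append by (auto simp: deque_walk_def big_walk_def)

lemma twosip_walk_imp_big_walk: "twosip_walk w \<Longrightarrow> big_walk w"
  by (auto simp: twosip_walk_def big_walk_def)

lemma twosip_walk_append:
  assumes "twosip_walk u" "twosip_walk v"
  shows "twosip_walk (u @ v)"
proof -
  have "big_walk (u @ v)" using assms big_walk_append twosip_walk_imp_big_walk by blast
  moreover have "fst (pt (u @ v) i) \<ge> 0 \<and> snd (pt (u @ v) i) \<ge> 0" if "i \<le> length (u @ v)" for i
    using that by (cases rule: pt_append_cases) (use assms in \<open>auto simp: twosip_walk_def\<close>)
  ultimately show ?thesis
    using assms by (auto simp: twosip_walk_def big_walk_def prod_eq_iff)
qed

text \<open>The prefix NN lifts \<open>w\<close> to heights at least 2, so every step from height 0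
  or 1 is one of the four added vertical steps. The junctions stay eager because a nonempty
  \<open>w\<close> starts with N or E and ends with S or W.\<close>

lemma deque_walk_lift:
  assumes "big_walk w"
  shows "deque_walk ([N, N] @ w @ [S, S])"
proof -
  have st: "standard (w @ [S, S])"
    using assms big_walk_min
    by (intro standard_append) (auto simp: big_walk_def intro!: standard_Cons_SW standard_Nil)
  have eag: "eager (w @ [S, S])"
    using assms big_walk_last[of w] eager_replicate[of 2 S] big_walk_def
    by (intro eager_append) (auto simp: numeral_2_eq_2)
  have ht: "height ([N, N] @ w @ [S, S]) (Suc (Suc k)) = 2 + height (w @ [S, S]) k" for k
    by simp
  have ht_S: "height [S, S] k = - int k" if "k \<le> 2" for k
    using that by (auto simp: le_Suc_eq numeral_2_eq_2)
  have low: "height (w @ [S, S]) k \<ge> -2" if "k \<le> length w + 2" for k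
  proof -
    have "k \<le> length (w @ [S, S])" using that by simp
    then show ?thesis
    proof (cases rule: pt_append_cases)
      case left
      then show ?thesis using assms by (auto simp: big_walk_def)
    next
      case (right j)
      then have "height [S, S] j = - int j" "j \<le> 2" using ht_S[of j] by auto
      then show ?thesis using right assms unfolding big_walk_def by linarith
    qed
  qed
  have "height ([N, N] @ w @ [S, S]) i \<ge> 0" if "i \<le> length w + 4" for i
  proof -
    consider "i = 0" | "i = Suc 0" | k where "i = Suc (Suc k)" by (metis not0_implies_Suc)
    then show ?thesis
    proof cases
      case 3
      then show ?thesis using low[of k] that ht[of k] by simp
    qed simp_all
  qed
  moreover have "height ([N, N] @ w @ [S, S]) (length w + 4) = 0"
    using ht[of "length w + 2"] fst_pt_append_right[of w "[S, S]" 2] snd_pt_append_right[of w "[S, S]" 2]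
      ht_S[of 2] assms
    unfolding big_walk_def by (simp add: eval_nat_numeral)
  moreover have "eager ([N, N] @ w @ [S, S])"
    using eag big_walk_hd[OF assms] eager_replicate[of 2 N]
    by (intro eager_append[of "[N, N]"]) (auto simp: numeral_2_eq_2 hd_append)
  moreover have "standard ([N, N] @ w @ [S, S])"
    using st by (auto intro!: standard_Cons_N)
  moreover have "vertical_happy ([N, N] @ w @ [S, S])"
    unfolding vertical_happy_def
  proof (intro allI impI)
    fix i assume i: "i < length ([N, N] @ w @ [S, S])"
      and h: "height ([N, N] @ w @ [S, S]) i = 0 \<or> height ([N, N] @ w @ [S, S]) i = 1"
    consider "i < 2" | "i \<ge> length w + 2" | "2 \<le> i" "i < length w + 2" by linarith
    then show "([N, N] @ w @ [S, S]) ! i = N \<or> ([N, N] @ w @ [S, S]) ! i = S"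
    proof cases
      case 1
      then show ?thesis by (auto simp: less_2_cases_iff)
    next
      case 2
      then have "i = length w + 2 \<or> i = length w + 3" using i by auto
      then show ?thesis by (auto simp: nth_append eval_nat_numeral)
    next
      case 3
      then obtain k where k: "i = Suc (Suc k)" "k < length w"
        by (metis add_2_eq_Suc add_2_eq_Suc' le_Suc_ex not_less_eq)
      then have "height w k \<ge> 0" using assms by (auto simp: big_walk_def)
      then show ?thesis using h k by simp
    qed
  qed
  ultimately show ?thesis
    by (simp add: deque_walk_def big_walk_def eval_nat_numeral del: fst_pt_Cons snd_pt_Cons)
qed

section \<open>Bordering a big-walk by the sides of a square\<close>

lemma fst_pt_replicate: "k \<le> n \<Longrightarrow> fst (pt (replicate n s) k) = int k * fst (delta s)"
  and snd_pt_replicate: "k \<le> n \<Longrightarrow> snd (pt (replicate n s) k) = int k * snd (delta s)"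
  by (simp_all add: pt_def)

text \<open>For a closed \<open>w\<close>, this runs along the square of side \<open>L\<close>
  through (0,L), (L,L) and (L,0), with \<open>w\<close> inserted at the far corner (L,L). The square
  is followed clockwise, starting with N, so the corners NE and SW are harmless; the forbidden
  corner ES is broken up by a nonempty \<open>w\<close>.\<close>

definition border :: "nat \<Rightarrow> step list \<Rightarrow> step list" where
  "border L w = replicate L N @ replicate L E @ w @ replicate L S @ replicate L W"

text \<open>The only danger in prepending E steps is a loop starting with one of them, which
  requires \<open>v\<close> to return to its initial level strictly to the left of its start. The
  invariant on abscissas at level 0 excludes this and is itself preserved by each new E step, hence
  the joint induction.\<close>

lemma standard_replicate_E:
  assumes "standard v" "\<And>k. k \<le> length v \<Longrightarrow> snd (pt v k) = 0 \<Longrightarrow> fst (pt v k) \<ge> 0"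
  shows "standard (replicate n E @ v) \<and>
    (\<forall>k \<le> n + length v. snd (pt (replicate n E @ v) k) = 0 \<longrightarrow> fst (pt (replicate n E @ v) k) \<ge> 0)"
proof (induction n)
  case 0
  then show ?case using assms by simp
next
  case (Suc n)
  let ?v = "replicate n E @ v"
  have "standard (E # ?v)"
  proof (rule standard_Cons)
    show "standard ?v" using Suc by simp
    fix j assume l: "qp_subloop (E # ?v) 0 j"
    note D = qp_subloopD[OF l]
    obtain k where k: "j = Suc k" using D(1) by (cases j) auto
    have "fst (pt ?v k) = -1" "snd (pt ?v k) = 0" "k \<le> n + length v" using D(2-4) k by simp_all
    then show "E = N" using Suc by force
  qed
  moreover have "fst (pt (E # ?v) k) \<ge> 0"
    if "k \<le> Suc n + length v" "snd (pt (E # ?v) k) = 0" for k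
    using that Suc by (cases k) force+
  ultimately show ?case by simp
qed

lemma standard_replicate_N: "standard v \<Longrightarrow> standard (replicate n N @ v)"
  by (induction n) (auto intro: standard_Cons_N)

lemma standard_replicate_SW: "standard v \<Longrightarrow> s = S \<or> s = W \<Longrightarrow> standard (replicate n s @ v)"
  by (induction n) (auto intro: standard_Cons_SW)

lemma twosip_walk_border:
  assumes w: "big_walk w" "w \<noteq> []" "pt w (length w) = (0, 0)"
    and box: "\<And>k. k \<le> length w \<Longrightarrow> fst (pt w k) \<ge> - int L \<and> snd (pt w k) \<ge> - int L"
  shows "twosip_walk (border L w)"
proof -
  let ?s = "replicate L S @ replicate L W"
  have st: "standard (w @ ?s)"
    using w big_walk_min standard_replicate_SW[OF standard_replicate_SW[OF standard_Nil]]
    by (intro standard_append[of w]) (auto simp: big_walk_def)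
  \<comment> \<open>Inside \<open>w\<close> the height is nonnegative, so ordinate 0 forces a
    nonnegative abscissa; after \<open>w\<close> the walk is strictly below level 0. This is the
    invariant needed for the E side.\<close>
  have "fst (pt (w @ ?s) k) \<ge> 0" if "k \<le> length (w @ ?s)" and z: "snd (pt (w @ ?s) k) = 0" for k
    using that(1)
  proof (cases rule: pt_append_cases)
    case left
    then show ?thesis using w z by (force simp: big_walk_def)
  next
    case (right j)
    from right(3) have "snd (pt ?s j) \<noteq> 0"
      by (cases rule: pt_append_cases) (use right(2) in \<open>auto simp: snd_pt_replicate\<close>)
    then show ?thesis using right z w by simp
  qed
  then have st': "standard (border L w)"
    unfolding border_def using standard_replicate_E[OF st] by (intro standard_replicate_N) simp
  have "eager (w @ ?s)"
    using w big_walk_last[OF w(1,2)]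
    by (intro eager_append[of w] eager_append[of "replicate L S"] eager_replicate)
      (auto simp: big_walk_def)
  then have eag: "eager (border L w)"
    unfolding border_def using big_walk_hd[OF w(1,2)] w(2)
    by (intro eager_append[of "replicate L N"] eager_append[of "replicate L E"] eager_replicate)
      (auto simp: hd_append hd_replicate)
  have "fst (pt (border L w) k) \<ge> 0 \<and> snd (pt (border L w) k) \<ge> 0" if "k \<le> length (border L w)" for k
    using that[unfolded border_def]
  proof (cases rule: pt_append_cases)
    case left
    then show ?thesis by (simp add: border_def fst_pt_replicate snd_pt_replicate)
  next
    case r1: (right a)
    from r1(3) show ?thesis
    proof (cases rule: pt_append_cases)
      case left
      then show ?thesis using r1 by (simp add: border_def fst_pt_replicate snd_pt_replicate)
    next
      case r2: (right b)
      from r2(3) show ?thesis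
      proof (cases rule: pt_append_cases)
        case left
        then show ?thesis using r1 r2 box[of b] by (simp add: border_def fst_pt_replicate snd_pt_replicate)
      next
        case r3: (right c)
        from r3(3) show ?thesis
          by (cases rule: pt_append_cases)
            (use r1 r2 r3 w(3) in \<open>auto simp: border_def fst_pt_replicate snd_pt_replicate\<close>)
      qed
    qed
  qed
  moreover have "pt (border L w) (length (border L w)) = (0, 0)"
    unfolding border_def prod_eq_iff fst_pt_append_end snd_pt_append_end
    by (simp add: fst_pt_replicate snd_pt_replicate w(3))
  ultimately show ?thesis using st' eag by (simp add: twosip_walk_def)
qed

section \<open>Mirroring a walk outside its loops\<close>

text \<open>Reflecting a whole walk in the diagonal would turn standard loops into loops beginning
  with an E step; keeping the steps inside loops unreflected repairs this without changing
  the set of loops.\<close>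

fun reflect :: "step \<Rightarrow> step" where
  "reflect N = E" | "reflect E = N" | "reflect S = W" | "reflect W = S"

definition in_loop :: "step list \<Rightarrow> nat \<Rightarrow> bool" where
  "in_loop w k \<longleftrightarrow> (\<exists>i j. qp_subloop w i j \<and> i \<le> k \<and> k < j)"

text \<open>Here \<open>k\<close> indexes a point strictly between the two ends of a loop, whereas
  in \<open>in_loop\<close> it indexes the step from point \<open>k\<close> to point
  \<open>k + 1\<close>. The non-interior times are those at which the mirrored walk sits at the
  reflected point.\<close>

definition interior :: "step list \<Rightarrow> nat \<Rightarrow> bool" where
  "interior w k \<longleftrightarrow> (\<exists>i j. qp_subloop w i j \<and> i < k \<and> k < j)"

definition mirror :: "step list \<Rightarrow> step list" where
  "mirror w = map (\<lambda>k. if in_loop w k then w ! k else reflect (w ! k)) [0..<length w]"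

lemma length_mirror [simp]: "length (mirror w) = length w"
  by (simp add: mirror_def)

lemma nth_mirror:
  "k < length w \<Longrightarrow> mirror w ! k = (if in_loop w k then w ! k else reflect (w ! k))"
  by (simp add: mirror_def)

lemma delta_reflect [simp]:
  "fst (delta (reflect s)) = snd (delta s)" "snd (delta (reflect s)) = fst (delta s)"
  by (cases s; simp)+

lemma reflect_reflect [simp]: "reflect (reflect s) = s"
  by (cases s) simp_all

lemma height_mirror: "k \<le> length w \<Longrightarrow> height (mirror w) k = height w k"
proof (induction k)
  case (Suc k)
  then have "height (mirror w) k = height w k" by simp
  then show ?case using Suc.prems by (simp add: fst_pt_Suc snd_pt_Suc nth_mirror)
qed simp

text \<open>All steps of a loop are kept, so \<open>mirror\<close> merely translates the
  loop.\<close>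

lemma pt_mirror_in_loop:
  assumes "qp_subloop w i j" "i \<le> k" "k \<le> j"
  shows "fst (pt (mirror w) k) - fst (pt (mirror w) i) = fst (pt w k) - fst (pt w i) \<and>
         snd (pt (mirror w) k) - snd (pt (mirror w) i) = snd (pt w k) - snd (pt w i)"
  using assms(2,3)
proof (induction k rule: dec_induct)
  case (step k)
  have "in_loop w k" unfolding in_loop_def using assms(1) step by (meson Suc_le_lessD)
  moreover have "k < length w" using qp_subloopD(2)[OF assms(1)] step by simp
  ultimately show ?case using step by (simp add: fst_pt_Suc snd_pt_Suc nth_mirror)
qed simp

text \<open>The base of the first loop bounds point \<open>k\<close> from below, and point
  \<open>k\<close> bounds point \<open>j\<close>, which is again the base of the first loop. Hence
  the two base points coincide and the loops merge. Loops that only touch, with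
  \<open>k = j\<close>, are included.\<close>

lemma qp_subloop_cross:
  assumes "qp_subloop w i j" "qp_subloop w k l" "i \<le> k" "k \<le> j" "j \<le> l"
  shows "qp_subloop w i l"
proof -
  note D1 = qp_subloopD[OF assms(1)] and D2 = qp_subloopD[OF assms(2)]
  have eq: "fst (pt w k) = fst (pt w i)" "snd (pt w k) = snd (pt w i)"
    using D1(3,4) D1(5,6)[OF assms(3,4)] D2(5,6)[OF assms(4,5)] by linarith+
  show ?thesis
  proof (rule qp_subloopI)
    fix m assume "i \<le> m" "m \<le> l"
    then show "fst (pt w i) \<le> fst (pt w m) \<and> snd (pt w i) \<le> snd (pt w m)"
      using D1(5,6)[of m] D2(5,6)[of m] eq assms(3-5) by (cases "m \<le> k") auto
  qed (use D1 D2 eq assms(5) in auto)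
qed

text \<open>A loop strictly surrounding an end of the maximal loop either contains the maximal loop
  or crosses it; in the second case \<open>qp_subloop_cross\<close> yields a strictly larger
  loop.\<close>

lemma maximal_loop_not_interior:
  assumes "qp_subloop w i j"
    and max: "\<And>i' j'. qp_subloop w i' j' \<Longrightarrow> i' \<le> i \<Longrightarrow> j \<le> j' \<Longrightarrow> i' = i \<and> j' = j"
  shows "\<not> interior w i" "\<not> interior w j"
proof -
  show "\<not> interior w i"
  proof
    assume "interior w i"
    then obtain i' j' where l: "qp_subloop w i' j'" "i' < i" "i < j'" by (auto simp: interior_def)
    then show False
      using max[OF l(1)] max[OF qp_subloop_cross[OF l(1) assms(1)]] by (cases "j' \<le> j") auto
  qed
  show "\<not> interior w j"
  proof
    assume "interior w j"
    then obtain i' j' where l: "qp_subloop w i' j'" "i' < j" "j < j'" by (auto simp: interior_def)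
    then show False
      using max[OF l(1)] max[OF qp_subloop_cross[OF assms(1) l(1)]] by (cases "i \<le> i'") auto
  qed
qed

lemma maximal_loop_exists:
  assumes "qp_subloop w i j"
  obtains a b where "a \<le> i" "j \<le> b" "qp_subloop w a b" "\<not> interior w a" "\<not> interior w b"
proof -
  define P where "P = (\<lambda>(a, b). qp_subloop w a b \<and> a \<le> i \<and> j \<le> b)"
  have P: "P (i, j)" using assms by (simp add: P_def)
  have bound: "\<forall>y. P y \<longrightarrow> (\<lambda>(a, b). b - a) y < Suc (length w)"
    by (auto simp: P_def qp_subloop_def)
  \<comment> \<open>Among the loops containing the given one, a longest one is maximal for
    inclusion.\<close>
  obtain a b where ab: "P (a, b)" and m: "\<And>a' b'. P (a', b') \<Longrightarrow> b' - a' \<le> b - a"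
    using ex_has_greatest_nat[OF P bound] by (auto simp: split_paired_all)
  have l: "qp_subloop w a b" "a \<le> i" "j \<le> b" using ab by (auto simp: P_def)
  have max: "i' = a \<and> j' = b" if "qp_subloop w i' j'" "i' \<le> a" "b \<le> j'" for i' j'
    using m[of i' j'] that l qp_subloopD(1)[OF l(1)] by (auto simp: P_def)
  show ?thesis using that[OF l(2,3,1)] maximal_loop_not_interior[OF l(1)] max by blast
qed

text \<open>Induction on time, jumping over maximal loops: a loop is closed in both walks, so it can
  be skipped back to its start, and a step outside all loops is reflected.\<close>

lemma pt_mirror_not_interior:
  assumes "k \<le> length w" "\<not> interior w k"
  shows "fst (pt (mirror w) k) = snd (pt w k) \<and> snd (pt (mirror w) k) = fst (pt w k)"
  using assms
proof (induction k rule: less_induct)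
  case (less k)
  show ?case
  proof (cases k)
    case (Suc m)
    show ?thesis
    proof (cases "in_loop w m")
      case True
      then obtain i j where "qp_subloop w i j" "i \<le> m" "m < j" by (auto simp: in_loop_def)
      then obtain a b where l: "a \<le> m" "m < b" "qp_subloop w a b" "\<not> interior w a"
        using maximal_loop_exists[of w i j] by (metis le_trans less_le_trans)
      \<comment> \<open>The maximal loop containing the last step cannot extend beyond
        \<open>k\<close>, since \<open>k\<close> is not interior.\<close>
      have "b = k"
      proof (rule ccontr)
        assume "b \<noteq> k"
        then have "a < k" "k < b" using l(1,2) Suc by auto
        then show False using less.prems(2) l(3) interior_def by blast
      qed
      then show ?thesis
        using less.IH[of a] l Suc pt_mirror_in_loop[OF l(3), of b] qp_subloopD[OF l(3)] less.prems(1)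
        by auto
    next
      case False
      then have "\<not> interior w m" unfolding interior_def in_loop_def by (meson less_imp_le_nat)
      then show ?thesis
        using less.IH[of m] Suc less.prems(1) False
        by (simp add: fst_pt_Suc snd_pt_Suc nth_mirror)
    qed
  qed simp
qed

text \<open>The interval around \<open>k\<close> is a maximal loop if \<open>k\<close> is interior
  and the single time \<open>k\<close> otherwise. Admitting \<open>a = b\<close> lets both
  situations be handled uniformly in the next proof.\<close>

lemma cluster:
  assumes "k \<le> length w"
  obtains a b where "a \<le> k" "k \<le> b" "b \<le> length w" "a < b \<Longrightarrow> qp_subloop w a b"
    "\<not> interior w a" "\<not> interior w b"
    "fst (pt w b) = fst (pt w a)" "snd (pt w b) = snd (pt w a)"
    "\<And>m. a \<le> m \<Longrightarrow> m \<le> b \<Longrightarrow> fst (pt w a) \<le> fst (pt w m) \<and> snd (pt w a) \<le> snd (pt w m)"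
    "\<And>m. a \<le> m \<Longrightarrow> m \<le> b \<Longrightarrow>
       fst (pt (mirror w) m) - fst (pt (mirror w) a) = fst (pt w m) - fst (pt w a) \<and>
       snd (pt (mirror w) m) - snd (pt (mirror w) a) = snd (pt w m) - snd (pt w a)"
proof (cases "interior w k")
  case False
  then show ?thesis using that[of k k] assms by auto
next
  case True
  then obtain i j where "qp_subloop w i j" "i < k" "k < j" by (auto simp: interior_def)
  then obtain a b where l: "a \<le> k" "k \<le> b" "qp_subloop w a b" "\<not> interior w a" "\<not> interior w b"
    using maximal_loop_exists[of w i j] by (metis le_trans less_imp_le_nat)
  show ?thesis
    using l qp_subloopD[OF l(3)] pt_mirror_in_loop[OF l(3)] by (intro that[of a b]) auto
qed

text \<open>Loops of \<open>w\<close> are only translated. Conversely, a loop of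
  \<open>mirror w\<close> is split at the clusters of its two ends: inside a cluster the mirror is a
  translation, and between clusters it swaps the coordinates at non-interior times. Domination in
  both coordinates is invariant under either operation.\<close>

lemma qp_subloop_mirror_iff: "qp_subloop (mirror w) i j \<longleftrightarrow> qp_subloop w i j"
proof
  assume l: "qp_subloop w i j"
  note D = qp_subloopD[OF l] and T = pt_mirror_in_loop[OF l]
  show "qp_subloop (mirror w) i j"
  proof (rule qp_subloopI)
    fix k assume k: "i \<le> k" "k \<le> j"
    show "fst (pt (mirror w) i) \<le> fst (pt (mirror w) k) \<and>
      snd (pt (mirror w) i) \<le> snd (pt (mirror w) k)"
      using D(5,6)[OF k] T[OF k] by linarith
  qed (use D T[of j] in auto)
next
  assume l: "qp_subloop (mirror w) i j"
  note D = qp_subloopD[OF l]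
  have ij: "i < j" "j \<le> length w" using D(1,2) by auto
  from ij have "i \<le> length w" by simp
  then obtain a b where ab: "a \<le> i" "i \<le> b" "b \<le> length w" "a < b \<Longrightarrow> qp_subloop w a b"
    "\<not> interior w a" "\<not> interior w b"
    "fst (pt w b) = fst (pt w a)" "snd (pt w b) = snd (pt w a)"
    "\<And>m. a \<le> m \<Longrightarrow> m \<le> b \<Longrightarrow> fst (pt w a) \<le> fst (pt w m) \<and> snd (pt w a) \<le> snd (pt w m)"
    "\<And>m. a \<le> m \<Longrightarrow> m \<le> b \<Longrightarrow>
       fst (pt (mirror w) m) - fst (pt (mirror w) a) = fst (pt w m) - fst (pt w a) \<and>
       snd (pt (mirror w) m) - snd (pt (mirror w) a) = snd (pt w m) - snd (pt w a)"
    using cluster by metis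
  obtain c d where cd: "c \<le> j" "j \<le> d" "d \<le> length w" "c < d \<Longrightarrow> qp_subloop w c d"
    "\<not> interior w c" "\<not> interior w d"
    "fst (pt w d) = fst (pt w c)" "snd (pt w d) = snd (pt w c)"
    "\<And>m. c \<le> m \<Longrightarrow> m \<le> d \<Longrightarrow> fst (pt w c) \<le> fst (pt w m) \<and> snd (pt w c) \<le> snd (pt w m)"
    "\<And>m. c \<le> m \<Longrightarrow> m \<le> d \<Longrightarrow>
       fst (pt (mirror w) m) - fst (pt (mirror w) c) = fst (pt w m) - fst (pt w c) \<and>
       snd (pt (mirror w) m) - snd (pt (mirror w) c) = snd (pt w m) - snd (pt w c)"
    using cluster ij(2) by metis
  \<comment> \<open>If one cluster covers the whole loop, the loop is a translate of the
    corresponding part of \<open>w\<close>.\<close>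
  have same: "qp_subloop w i j"
    if T: "\<And>m. i \<le> m \<Longrightarrow> m \<le> j \<Longrightarrow>
      fst (pt (mirror w) m) - fst (pt (mirror w) e) = fst (pt w m) - fst (pt w e) \<and>
      snd (pt (mirror w) m) - snd (pt (mirror w) e) = snd (pt w m) - snd (pt w e)" for e
  proof (rule qp_subloopI)
    fix k assume k: "i \<le> k" "k \<le> j"
    show "fst (pt w i) \<le> fst (pt w k) \<and> snd (pt w i) \<le> snd (pt w k)"
      using D(5,6)[OF k] T[OF k] T[of i] ij by linarith
  qed (use ij D(3,4) T[of i] T[of j] in auto)
  consider "j \<le> b" | "c \<le> i" | "b < j" "i < c" by linarith
  then show "qp_subloop w i j"
  proof cases
    case 1
    then show ?thesis using ab(1,10) by (intro same[of a]) auto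
  next
    case 2
    then show ?thesis using cd(2,10) by (intro same[of c]) auto
  next
    case 3
    \<comment> \<open>Point \<open>b\<close> dominates point \<open>i\<close> as part of the loop of
      \<open>mirror w\<close>, and it is dominated by point \<open>i\<close> because
      \<open>b\<close> is at the base of the cluster. The same argument gives
      \<open>cj\<close>.\<close>
    have bi: "fst (pt (mirror w) b) = fst (pt (mirror w) i)" "snd (pt (mirror w) b) = snd (pt (mirror w) i)"
      using D(5,6)[of b] ab(10)[of i] ab(10)[of b] ab(9)[of i] ab(7,8) ab(1,2) 3 by force+
    have cj: "fst (pt (mirror w) c) = fst (pt (mirror w) i)" "snd (pt (mirror w) c) = snd (pt (mirror w) i)"
      using D(3,4) D(5,6)[of c] cd(10)[of j] cd(9)[of j] cd(1,2) 3 by force+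
    \<comment> \<open>Otherwise \<open>c\<close> would be interior to the loop from \<open>a\<close>
      to \<open>b\<close>.\<close>
    have "b \<le> c"
    proof (rule ccontr)
      assume "\<not> b \<le> c"
      then have "a < c" "c < b" using ab(1) 3 by auto
      then show False using ab(4) cd(5) by (auto simp: interior_def)
    qed
    have pi: "fst (pt w i) = fst (pt w b)" "snd (pt w i) = snd (pt w b)"
      using ab(10)[of i] ab(10)[of b] ab(1,2) bi by auto
    have pj: "fst (pt w j) = fst (pt w c)" "snd (pt w j) = snd (pt w c)"
      using cd(10)[of j] cd(1,2) cj D(3,4) by auto
    have out: "fst (pt (mirror w) m) = snd (pt w m)" "snd (pt (mirror w) m) = fst (pt w m)"
      if "m \<le> length w" "\<not> interior w m" for m
      using pt_mirror_not_interior[OF that] by auto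
    have bc: "fst (pt w c) = fst (pt w b)" "snd (pt w c) = snd (pt w b)"
      using out[OF ab(3,6)] out[of c] cd(1,5) ij(2) bi cj by auto
    \<comment> \<open>A point between the clusters dominates the base of its own cluster. That base
      is at a non-interior time, where swapping coordinates transfers the domination known for
      \<open>mirror w\<close>.\<close>
    have mid: "fst (pt w b) \<le> fst (pt w m) \<and> snd (pt w b) \<le> snd (pt w m)" if m: "b \<le> m" "m \<le> c" for m
    proof (cases "m = b")
      case False
      have "m \<le> length w" using m cd(1) ij(2) by simp
      then obtain e f where ef: "e \<le> m" "m \<le> f" "e < f \<Longrightarrow> qp_subloop w e f" "\<not> interior w e"
        "\<And>m. e \<le> m \<Longrightarrow> m \<le> f \<Longrightarrow> fst (pt w e) \<le> fst (pt w m) \<and> snd (pt w e) \<le> snd (pt w m)"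
        using cluster by metis
      have "b \<le> e"
      proof (rule ccontr)
        assume "\<not> b \<le> e"
        then have "e < b" "b < f" using ef(1,2) False m by auto
        then show False using ef(3) ab(6) interior_def by (meson less_trans)
      qed
      then have "fst (pt (mirror w) i) \<le> fst (pt (mirror w) e) \<and> snd (pt (mirror w) i) \<le> snd (pt (mirror w) e)"
        using D(5,6)[of e] ab(2) ef(1) m cd(1) by auto
      then show ?thesis
        using out[of e] out[OF ab(3,6)] ef(1,2,4) ef(5)[of m] bi \<open>m \<le> length w\<close> by auto
    qed simp
    show ?thesis
    proof (rule qp_subloopI)
      fix m assume m: "i \<le> m" "m \<le> j"
      consider "m \<le> b" | "b \<le> m" "m \<le> c" | "c \<le> m" by linarith
      then show "fst (pt w i) \<le> fst (pt w m) \<and> snd (pt w i) \<le> snd (pt w m)"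
      proof cases
        case 1
        then show ?thesis using ab(1,7,8) ab(9)[of m] m pi by auto
      next
        case 2
        then show ?thesis using mid pi by auto
      next
        case 3
        then show ?thesis using cd(2) cd(9)[of m] m pi bc by auto
      qed
    qed (use ij pi pj bc in auto)
  qed
qed

section \<open>The mirror as an involution on big-walks\<close>

lemma in_loop_mirror: "in_loop (mirror w) k = in_loop w k"
  by (simp add: in_loop_def qp_subloop_mirror_iff)

lemma mirror_mirror [simp]: "mirror (mirror w) = w"
  by (rule nth_equalityI) (simp_all add: nth_mirror in_loop_mirror)

text \<open>The loops are the same, and the first step of a loop lies in that loop, so it is
  kept.\<close>

lemma standard_mirror: "standard w \<Longrightarrow> standard (mirror w)"
  unfolding standard_def qp_subloop_mirror_iff
proof (intro allI impI)
  fix i j assume "\<forall>i j. qp_subloop w i j \<longrightarrow> w ! i = N" and l: "qp_subloop w i j"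
  then have "w ! i = N" "in_loop w i" "i < length w"
    using qp_subloopD(1,2)[OF l] by (auto simp: in_loop_def)
  then show "mirror w ! i = N" by (simp add: nth_mirror)
qed

text \<open>Reflection exchanges the forbidden pairs ES and NW, so only pairs with exactly one
  reflected step matter. There the kept step either begins a loop, hence is N or E, or ends one,
  hence is S or W; neither fits into a forbidden pair.\<close>

lemma eager_mirror:
  assumes "eager w"
  shows "eager (mirror w)"
  unfolding eager_def
proof (intro allI impI)
  fix k assume "Suc k < length (mirror w)"
  then have k: "Suc k < length w" by simp
  have start: "w ! Suc k \<in> {N, E}" if "in_loop w (Suc k)" "\<not> in_loop w k"
  proof -
    from that(1) obtain i j where l: "qp_subloop w i j" "i \<le> Suc k" "Suc k < j"
      unfolding in_loop_def by blast
    have "i = Suc k"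
    proof (rule ccontr)
      assume "i \<noteq> Suc k"
      then show False using that(2) l unfolding in_loop_def by (meson Suc_lessD le_SucE)
    qed
    then show ?thesis using qp_subloopD(5,6)[OF l(1), of "Suc (Suc k)"] l
      by (cases "w ! Suc k") (auto simp: fst_pt_Suc snd_pt_Suc)
  qed
  have stop: "w ! k \<in> {S, W}" if "in_loop w k" "\<not> in_loop w (Suc k)"
  proof -
    from that(1) obtain i j where l: "qp_subloop w i j" "i \<le> k" "k < j"
      unfolding in_loop_def by blast
    have "j = Suc k"
    proof (rule ccontr)
      assume "j \<noteq> Suc k"
      then have "i \<le> Suc k" "Suc k < j" using l(2,3) by auto
      then show False using that(2) l(1) unfolding in_loop_def by blast
    qed
    then show ?thesis using qp_subloopD(3,4)[OF l(1)] qp_subloopD(5,6)[OF l(1), of k] l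
      by (cases "w ! k") (auto simp: fst_pt_Suc snd_pt_Suc)
  qed
  have "\<not> (w ! k = E \<and> w ! Suc k = S) \<and> \<not> (w ! k = N \<and> w ! Suc k = W)"
    using assms k by (simp add: eager_def)
  then show "\<not> (mirror w ! k = E \<and> mirror w ! Suc k = S) \<and>
    \<not> (mirror w ! k = N \<and> mirror w ! Suc k = W)"
    using start stop k
    by (cases "w ! k"; cases "w ! Suc k") (auto simp: nth_mirror)
qed

lemma big_walk_mirror: "big_walk w \<Longrightarrow> big_walk (mirror w)"
  using standard_mirror eager_mirror height_mirror by (auto simp: big_walk_def)

text \<open>The final time is never interior, so the end point \<open>(x, -x)\<close> is reflected
  to \<open>(-x, x)\<close>.\<close>

lemma fst_pt_mirror_end:
  assumes "big_walk w"
  shows "fst (pt (mirror w) (length w)) = - fst (pt w (length w))"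
proof -
  have "\<not> interior w (length w)" by (auto simp: interior_def qp_subloop_def)
  then show ?thesis using pt_mirror_not_interior[of "length w" w] assms by (simp add: big_walk_def)
qed

section \<open>Counting\<close>

definition walks :: "(step list \<Rightarrow> bool) \<Rightarrow> nat \<Rightarrow> step list set" where
  "walks P n = {w. length w = n \<and> P w}"

lemma UNIV_step: "(UNIV :: step set) = {N, E, S, W}"
proof -
  have "s \<in> {N, E, S, W}" for s by (cases s) auto
  then show ?thesis by blast
qed

lemma finite_walks [simp]: "finite (walks P n)"
proof -
  have "finite {w :: step list. set w \<subseteq> UNIV \<and> length w = n}"
    by (rule finite_lists_length_eq) (simp add: UNIV_step)
  then show ?thesis by (rule rev_finite_subset) (auto simp: walks_def)
qed

lemma card_walks_le: "card (walks P n) \<le> 4 ^ n"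
proof -
  have fin: "finite (UNIV :: step set)" by (simp add: UNIV_step)
  have "card (walks P n) \<le> card {w :: step list. set w \<subseteq> UNIV \<and> length w = n}"
    by (rule card_mono[OF finite_lists_length_eq[OF fin]]) (auto simp: walks_def)
  also have "\<dots> = 4 ^ n"
    by (subst card_lists_length_eq[OF fin]) (simp add: UNIV_step eval_nat_numeral)
  finally show ?thesis .
qed

text \<open>With the length of the first factor fixed, a concatenation determines both
  factors.\<close>

lemma card_walks_append:
  assumes "\<And>u v. P u \<Longrightarrow> Q v \<Longrightarrow> R (u @ v)"
  shows "card (walks P m) * card (walks Q n) \<le> card (walks R (m + n))"
proof -
  have "inj_on (\<lambda>(u, v). u @ v) (walks P m \<times> walks Q n)"
    by (auto simp: inj_on_def walks_def)
  moreover have "(\<lambda>(u, v). u @ v) ` (walks P m \<times> walks Q n) \<subseteq> walks R (m + n)"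
    using assms by (auto simp: walks_def)
  ultimately have "card (walks P m \<times> walks Q n) \<le> card (walks R (m + n))"
    using card_inj_on_le finite_walks by blast
  then show ?thesis by (simp add: card_cartesian_product)
qed

lemma card_walks_power:
  assumes "P []" "\<And>u v. P u \<Longrightarrow> P v \<Longrightarrow> P (u @ v)"
  shows "card (walks P n) ^ m \<le> card (walks P (m * n))"
proof (induction m)
  case 0
  have "walks P 0 = {[]}" using assms(1) by (auto simp: walks_def)
  then show ?case by simp
next
  case (Suc m)
  have "card (walks P n) ^ Suc m \<le> card (walks P n) * card (walks P (m * n))"
    using Suc by simp
  also have "\<dots> \<le> card (walks P (n + m * n))"
    using assms(2) by (rule card_walks_append)
  finally show ?case by simp
qed

lemma card_walks_inj:
  assumes "\<And>w. P w \<Longrightarrow> length w = m \<Longrightarrow> Q (f w) \<and> length (f w) = n" "inj_on f (walks P m)"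
  shows "card (walks P m) \<le> card (walks Q n)"
proof (rule card_inj_on_le[OF assms(2) _ finite_walks])
  show "f ` walks P m \<subseteq> walks Q n" using assms(1) by (auto simp: walks_def)
qed

lemma p_count_walks: "p_count n = card (walks twosip_walk (2 * n))"
  and d_count_walks: "d_count n = card (walks deque_walk (2 * n))"
  and b_count_walks: "b_count n = card (walks big_walk (2 * n))"
  by (simp_all add: p_count_def d_count_def b_count_def walks_def)

lemma twosip_walk_Nil: "twosip_walk []"
  by (simp add: twosip_walk_def standard_Nil eager_def)

lemma deque_walk_Nil: "deque_walk []"
  using twosip_walk_imp_big_walk[OF twosip_walk_Nil] by (simp add: deque_walk_def vertical_happy_def)

lemma twosip_walk_NS: "twosip_walk [N, S]"
  using standard_Cons_N[OF standard_Cons_SW[OF standard_Nil, of S]]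
  by (auto simp: twosip_walk_def eager_def less_Suc_eq le_Suc_eq prod_eq_iff)

lemma deque_walk_NS: "deque_walk [N, S]"
  using twosip_walk_imp_big_walk[OF twosip_walk_NS]
  by (auto simp: deque_walk_def vertical_happy_def less_Suc_eq)

text \<open>Powers of NS provide a walk of every even length. The lower bound 1 is required by the
  limit argument for roots.\<close>

lemma card_walks_pos:
  assumes "P []" "\<And>u v. P u \<Longrightarrow> P v \<Longrightarrow> P (u @ v)" "P [N, S]"
  shows "card (walks P (2 * n)) \<ge> 1"
proof -
  have "{[N, S]} \<subseteq> walks P 2" using assms(3) by (simp add: walks_def)
  from card_mono[OF finite_walks this] have "card (walks P 2) \<ge> 1" by simp
  then have "1 \<le> card (walks P 2) ^ n" by simp
  also have "\<dots> \<le> card (walks P (2 * n))"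
    using card_walks_power[of P, OF assms(1,2), of 2 n] by (simp add: mult.commute)
  finally show ?thesis .
qed

lemma p_count_pos: "p_count n \<ge> 1"
  unfolding p_count_walks
  by (rule card_walks_pos) (simp_all add: twosip_walk_Nil twosip_walk_append twosip_walk_NS)

lemma d_count_pos: "d_count n \<ge> 1"
  unfolding d_count_walks
  by (rule card_walks_pos) (simp_all add: deque_walk_Nil deque_walk_append deque_walk_NS)

lemma p_count_le_b_count: "p_count n \<le> b_count n"
  unfolding p_count_walks b_count_walks
  by (rule card_mono) (auto simp: walks_def finite_walks[unfolded walks_def] twosip_walk_imp_big_walk)

lemma d_count_le_b_count: "d_count n \<le> b_count n"
  unfolding d_count_walks b_count_walks
  by (rule card_mono) (auto simp: walks_def finite_walks[unfolded walks_def] deque_walk_def)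

lemma b_count_le_d_count: "b_count n \<le> d_count (n + 2)"
  unfolding d_count_walks b_count_walks
  by (rule card_walks_inj[where f = "\<lambda>w. [N, N] @ w @ [S, S]"])
    (use deque_walk_lift in \<open>auto simp: inj_on_def\<close>)

section \<open>Comparing all big-walks, closed big-walks and 2sip-walks\<close>

abbreviation big_walk_to :: "int \<Rightarrow> step list \<Rightarrow> bool" where
  "big_walk_to x w \<equiv> big_walk w \<and> fst (pt w (length w)) = x"

lemma card_big_walk_to_uminus: "card (walks (big_walk_to x) n) \<le> card (walks (big_walk_to (- x)) n)"
proof (rule card_walks_inj[where f = mirror])
  fix w assume "big_walk_to x w" "length w = n"
  then show "big_walk_to (- x) (mirror w) \<and> length (mirror w) = n"
    using big_walk_mirror[of w] fst_pt_mirror_end[of w] by simp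
next
  show "inj_on mirror (walks (big_walk_to x) n)" by (metis inj_onI mirror_mirror)
qed

text \<open>A pigeonhole argument: the final abscissa takes at most \<open>4 * n + 1\<close> values.
  If \<open>x\<close> is the most frequent one, walks ending at \<open>x\<close> followed by walks
  ending at \<open>- x\<close> are closed, and the mirror shows that the second kind is as numerous
  as the first.\<close>

lemma b_count_square_le:
  "(b_count n)\<^sup>2 \<le> (4 * n + 1)\<^sup>2 * card (walks (big_walk_to 0) (2 * (2 * n)))"
proof -
  let ?X = "{- (2 * int n) .. 2 * int n}"
  define M where "M = Max ((\<lambda>x. card (walks (big_walk_to x) (2 * n))) ` ?X)"
  have "walks big_walk (2 * n) \<subseteq> (\<Union>x\<in>?X. walks (big_walk_to x) (2 * n))"
  proof
    fix w assume w: "w \<in> walks big_walk (2 * n)"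
    then show "w \<in> (\<Union>x\<in>?X. walks (big_walk_to x) (2 * n))"
      using abs_pt_le[of w "length w"] by (auto simp: walks_def abs_le_iff)
  qed
  then have "b_count n \<le> card (\<Union>x\<in>?X. walks (big_walk_to x) (2 * n))"
    unfolding b_count_walks by (intro card_mono) auto
  also have "\<dots> \<le> (\<Sum>x\<in>?X. card (walks (big_walk_to x) (2 * n)))"
    by (rule card_UN_le) simp
  also have "\<dots> \<le> (\<Sum>x\<in>?X. M)"
    unfolding M_def by (intro sum_mono Max_ge) auto
  also have "\<dots> = (4 * n + 1) * M" by (simp add: nat_add_distrib nat_mult_distrib)
  finally have b: "b_count n \<le> (4 * n + 1) * M" .
  have "M \<in> (\<lambda>x. card (walks (big_walk_to x) (2 * n))) ` ?X"
    unfolding M_def by (intro Max_in) auto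
  then obtain x where x: "M = card (walks (big_walk_to x) (2 * n))" by blast
  have "M * M \<le> card (walks (big_walk_to x) (2 * n)) * card (walks (big_walk_to (- x)) (2 * n))"
    unfolding x by (intro mult_le_mono2 card_big_walk_to_uminus)
  also have "\<dots> \<le> card (walks (big_walk_to 0) (2 * n + 2 * n))"
    by (rule card_walks_append) (simp add: big_walk_append)
  finally have "M\<^sup>2 \<le> card (walks (big_walk_to 0) (2 * (2 * n)))"
    by (simp add: power2_eq_square mult_2)
  then have "(4 * n + 1)\<^sup>2 * M\<^sup>2 \<le> (4 * n + 1)\<^sup>2 * card (walks (big_walk_to 0) (2 * (2 * n)))"
    by (rule mult_le_mono2)
  moreover have "(b_count n)\<^sup>2 \<le> (4 * n + 1)\<^sup>2 * M\<^sup>2"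
    using power_mono[OF b, of 2] by (simp only: power_mult_distrib)
  ultimately show ?thesis by linarith
qed

lemma card_big_walk_to_0_power_le:
  assumes "m \<ge> 1" "n \<ge> 1"
  shows "card (walks (big_walk_to 0) (2 * n)) ^ m \<le> p_count (m * n + 4 * n)"
proof -
  \<comment> \<open>The bound on the coordinates is automatic for walks of length
    \<open>2 * n\<close>. Making it part of \<open>P\<close> carries it over to concatenations of
    any number of closed walks.\<close>
  define P where "P w \<longleftrightarrow> big_walk_to 0 w \<and>
    (\<forall>k \<le> length w. fst (pt w k) \<ge> - int (2 * n) \<and> snd (pt w k) \<ge> - int (2 * n))" for w
  have end0: "pt w (length w) = (0, 0)" if "P w" for w
    using that by (simp add: P_def big_walk_def prod_eq_iff)
  have "walks (big_walk_to 0) (2 * n) = walks P (2 * n)"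
  proof -
    have "fst (pt w k) \<ge> - int (2 * n) \<and> snd (pt w k) \<ge> - int (2 * n)" if "k \<le> 2 * n" for w k
      using abs_pt_le[of w k] that by linarith
    then show ?thesis by (auto simp: walks_def P_def)
  qed
  moreover have "card (walks P (2 * n)) ^ m \<le> card (walks P (m * (2 * n)))"
  proof (rule card_walks_power)
    show "P []" using twosip_walk_imp_big_walk[OF twosip_walk_Nil] by (simp add: P_def)
    fix u v assume uv: "P u" "P v"
    have "fst (pt (u @ v) k) \<ge> - int (2 * n) \<and> snd (pt (u @ v) k) \<ge> - int (2 * n)"
      if "k \<le> length (u @ v)" for k
      using that
      by (cases rule: pt_append_cases) (use uv end0[OF uv(1)] in \<open>auto simp: P_def\<close>)
    then show "P (u @ v)" using uv big_walk_append by (simp add: P_def)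
  qed
  moreover have "card (walks P (m * (2 * n))) \<le> p_count (m * n + 4 * n)"
    unfolding p_count_walks
  \<comment> \<open>The four sides add \<open>8 * n\<close> steps, that is \<open>4 * n\<close> in
    the index of \<open>p_count\<close>, independently of \<open>m\<close>.\<close>
  proof (rule card_walks_inj[where f = "border (2 * n)"])
    fix w assume w: "P w" "length w = m * (2 * n)"
    then have "w \<noteq> []" using assms by auto
    then show "twosip_walk (border (2 * n) w) \<and> length (border (2 * n) w) = 2 * (m * n + 4 * n)"
      using w end0[OF w(1)] twosip_walk_border[of w "2 * n"] by (simp add: P_def border_def)
  qed (auto simp: inj_on_def border_def)
  ultimately show ?thesis by simp
qed

section \<open>Growth rates\<close>

lemma root_const_mult_limit:
  assumes "c > 0"
  shows "(\<lambda>n. root n (c * real n)) \<longlonglongrightarrow> 1"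
  using tendsto_mult[OF LIMSEQ_root_const[OF assms] LIMSEQ_root] by (simp add: real_root_mult)

text \<open>Fekete's lemma in multiplicative form. The limit is the supremum of the roots, which
  also gives the bound \<open>a n \<le> \<mu> ^ n\<close> for each individual
  \<open>n\<close>.\<close>

lemma supermultiplicative_root_limit:
  fixes a :: "nat \<Rightarrow> real"
  assumes super: "\<And>m n. a m * a n \<le> a (m + n)"
    and ge_1: "\<And>n. a n \<ge> 1" and bound: "\<And>n. a n \<le> C ^ n" and "C \<ge> 0"
  obtains \<mu> where "\<mu> \<ge> 1" "(\<lambda>n. root n (a n)) \<longlonglongrightarrow> \<mu>" "\<And>n. a n \<le> \<mu> ^ n"
proof -
  define r where "r n = root n (a n)" for n
  \<comment> \<open>The index 0 is left out because \<open>root 0\<close> is 0 by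
    convention.\<close>
  define \<mu> where "\<mu> = (SUP n\<in>{1..}. r n)"
  have r_power: "r n ^ n = a n" if "n \<ge> 1" for n
    using ge_1[of n] that by (simp add: r_def)
  have r_ge_1: "r n \<ge> 1" if "n \<ge> 1" for n
    using ge_1[of n] that by (simp add: r_def)
  have "r n \<le> C" if "n \<ge> 1" for n
    using real_root_le_mono[OF _ bound[of n], of n] that \<open>C \<ge> 0\<close>
    by (simp add: r_def real_root_power_cancel)
  then have bdd: "bdd_above (r ` {1..})" by (auto intro!: bdd_aboveI[of _ C])
  have r_le: "r n \<le> \<mu>" if "n \<ge> 1" for n
    unfolding \<mu>_def using that by (intro cSUP_upper bdd) simp
  have mu: "\<mu> \<ge> 1" using r_ge_1[of 1] r_le[of 1] by simp
  have le: "a n \<le> \<mu> ^ n" for n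
  proof (cases "n = 0")
    case False
    then have "r n ^ n \<le> \<mu> ^ n" using r_le[of n] r_ge_1[of n] by (intro power_mono) auto
    then show ?thesis using r_power[of n] False by simp
  qed (use bound[of 0] in simp)
  have pow: "a m ^ q \<le> a (q * m)" if "m \<ge> 1" for m q
  proof (induction q)
    case (Suc q)
    have "a m ^ Suc q \<le> a m * a (q * m)" using Suc ge_1[of m] by simp
    also have "\<dots> \<le> a (m + q * m)" by (rule super)
    finally show ?case by simp
  qed (simp add: ge_1)
  have "r \<longlonglongrightarrow> \<mu>"
  proof (rule order_tendstoI)
    fix y assume "\<mu> < y"
    then show "eventually (\<lambda>n. r n < y) sequentially"
      using r_le by (intro eventually_sequentiallyI[of 1]) (meson le_less_trans)
  next
    fix y assume y: "y < \<mu>"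
    show "eventually (\<lambda>n. y < r n) sequentially"
    proof (cases "y < 1")
      case True
      then show ?thesis
        using r_ge_1 by (intro eventually_sequentiallyI[of 1]) (meson less_le_trans)
    next
      case False
      obtain m where m: "m \<ge> 1" "y < r m"
        using y less_cSUP_iff[OF _ bdd, of y] unfolding \<mu>_def by auto
      \<comment> \<open>The gap between \<open>y\<close> and \<open>z\<close> absorbs a factor
        tending to 1; \<open>z \<ge> 1\<close> makes its powers monotone.\<close>
      obtain z where z: "y < z" "z < r m" using m(2) dense by blast
      have z1: "z \<ge> 1" using z False by simp
      have zm: "z ^ m \<le> a m" using z z1 r_power[OF m(1)] power_mono[of z "r m" m] by simp
      \<comment> \<open>Division of \<open>n\<close> by \<open>m\<close> with quotient
        \<open>q\<close> gives \<open>a n \<ge> a m ^ q \<ge> z ^ (n - m)\<close>; the lost factor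
        \<open>z ^ m\<close> is constant in \<open>n\<close>.\<close>
      have lower: "root n (inverse (z ^ m)) * z \<le> r n" if n: "n \<ge> m" for n
      proof -
        have n1: "n \<ge> 1" using n m(1) by simp
        define q where "q = n div m"
        have n_eq: "q * m + n mod m = n" by (simp add: q_def)
        have "n mod m < m" using m(1) by simp
        then have "n - m \<le> q * m" using n_eq by linarith
        then have "z ^ (n - m) \<le> z ^ (q * m)" using z1 by (rule power_increasing)
        also have "\<dots> = (z ^ m) ^ q" by (simp add: power_mult mult.commute)
        also have "\<dots> \<le> a m ^ q" using zm z1 by (intro power_mono) auto
        also have "\<dots> \<le> a (q * m)" by (rule pow[OF m(1)])
        also have "\<dots> \<le> a (q * m) * a (n mod m)"
          using ge_1[of "q * m"] ge_1[of "n mod m"] by simp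
        also have "\<dots> \<le> a n" using super[of "q * m" "n mod m"] n_eq by simp
        finally have "inverse (z ^ m) * z ^ n \<le> a n"
          using z1 n by (simp add: power_diff field_simps)
        then have "root n (inverse (z ^ m) * z ^ n) \<le> r n"
          unfolding r_def using n1 by (intro real_root_le_mono) auto
        then show ?thesis using n1 z1 by (simp add: real_root_mult real_root_power_cancel)
      qed
      have "(\<lambda>n. root n (inverse (z ^ m)) * z) \<longlonglongrightarrow> 1 * z"
        using z1 by (intro tendsto_mult LIMSEQ_root_const tendsto_const) auto
      then have "eventually (\<lambda>n. y < root n (inverse (z ^ m)) * z) sequentially"
        using z(1) by (intro order_tendstoD(1)) auto
      then show ?thesis
        using eventually_ge_at_top[of m] by eventually_elim (use lower in force)
    qed
  qed
  then show ?thesis using that mu le unfolding r_def by blast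
qed

text \<open>The factor \<open>f\<close> is subexponential and hence invisible to the growth
  rate.\<close>

lemma root_limit_le:
  fixes a :: "nat \<Rightarrow> real"
  assumes "(\<lambda>n. root n (a n)) \<longlonglongrightarrow> \<mu>" "(\<lambda>n. root n (f n)) \<longlonglongrightarrow> 1"
    and le: "\<And>n. n \<ge> 1 \<Longrightarrow> a n \<le> f n * \<nu> ^ n" and "\<nu> \<ge> 0"
  shows "\<mu> \<le> \<nu>"
proof -
  have "(\<lambda>n. root n (f n) * \<nu>) \<longlonglongrightarrow> 1 * \<nu>"
    using assms(2) by (intro tendsto_mult tendsto_const)
  moreover have "\<exists>k. \<forall>n\<ge>k. root n (a n) \<le> root n (f n) * \<nu>"
  proof (intro exI[of _ 1] allI impI)
    fix n :: nat assume n: "n \<ge> 1"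
    then have "root n (a n) \<le> root n (f n * \<nu> ^ n)" using le[OF n] by (intro real_root_le_mono) auto
    then show "root n (a n) \<le> root n (f n) * \<nu>"
      using n \<open>\<nu> \<ge> 0\<close> by (simp add: real_root_mult real_root_power_cancel)
  qed
  ultimately show ?thesis using LIMSEQ_le[OF assms(1)] by fastforce
qed

text \<open>The power trick: if \<open>x / y > 1\<close>, its powers would exceed every
  constant.\<close>

lemma le_of_power_le_const_mult:
  fixes x y :: real
  assumes "y > 0" "\<And>m. m \<ge> 1 \<Longrightarrow> x ^ m \<le> c * y ^ m"
  shows "x \<le> y"
proof (rule ccontr)
  assume "\<not> x \<le> y"
  then have "x / y > 1" using assms(1) by simp
  then obtain m where m: "c < (x / y) ^ m" using real_arch_pow by blast
  have "(x / y) ^ m \<le> (x / y) ^ Suc m" using \<open>x / y > 1\<close> by (intro power_increasing) auto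
  also have "\<dots> \<le> c" using assms(2)[of "Suc m"] assms(1) by (simp add: power_divide field_simps)
  finally show False using m by simp
qed

theorem theorem2p1:
  shows "\<exists>\<mu>::real.
     (\<lambda>n. root n (real (p_count n))) \<longlonglongrightarrow> \<mu> \<and>
     (\<lambda>n. root n (real (d_count n))) \<longlonglongrightarrow> \<mu> \<and>
     (\<lambda>n. root n (real (b_count n))) \<longlonglongrightarrow> \<mu>"
proof -
  have limit: thesis
    if eq: "\<And>n. a n = card (walks P (2 * n))" and app: "\<And>u v. P u \<Longrightarrow> P v \<Longrightarrow> P (u @ v)"
      and pos: "\<And>n. a n \<ge> 1"
      and *: "\<And>\<mu>. \<mu> \<ge> 1 \<Longrightarrow> (\<lambda>n. root n (real (a n))) \<longlonglongrightarrow> \<mu> \<Longrightarrow>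
        (\<And>n. real (a n) \<le> \<mu> ^ n) \<Longrightarrow> thesis" for a P thesis
  \<comment> \<open>There are \<open>4 ^ (2 * n) = 16 ^ n\<close> step sequences of length
    \<open>2 * n\<close>.\<close>
  proof (rule supermultiplicative_root_limit[where a = "\<lambda>n. real (a n)" and C = 16])
    fix m n
    have "a m * a n \<le> a (m + n)"
      using card_walks_append[of P P P "2 * m" "2 * n"] app by (simp add: eq algebra_simps)
    then show "real (a m) * real (a n) \<le> real (a (m + n))"
      by (simp flip: of_nat_mult)
    have "a n \<le> 16 ^ n" using card_walks_le[of P "2 * n"] by (simp add: eq power_mult)
    then have "real (a n) \<le> real (16 ^ n)" by (simp only: of_nat_le_iff)
    then show "real (a n) \<le> 16 ^ n" by simp
    show "1 \<le> real (a n)" using pos[of n] by simp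
  qed (use * in auto)
  have b_pos: "b_count n \<ge> 1" for n
    using p_count_pos p_count_le_b_count le_trans by blast
  obtain p where p: "p \<ge> 1" "(\<lambda>n. root n (real (p_count n))) \<longlonglongrightarrow> p" "\<And>n. real (p_count n) \<le> p ^ n"
    using limit[OF p_count_walks twosip_walk_append p_count_pos] by blast
  obtain d where d: "d \<ge> 1" "(\<lambda>n. root n (real (d_count n))) \<longlonglongrightarrow> d" "\<And>n. real (d_count n) \<le> d ^ n"
    using limit[OF d_count_walks deque_walk_append d_count_pos] by blast
  obtain b where b: "b \<ge> 1" "(\<lambda>n. root n (real (b_count n))) \<longlonglongrightarrow> b" "\<And>n. real (b_count n) \<le> b ^ n"
    using limit[OF b_count_walks big_walk_append b_pos] by blast
  have root_1: "(\<lambda>n. root n 1) \<longlonglongrightarrow> 1" by (rule LIMSEQ_root_const) simp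
  have "p \<le> b"
  proof (rule root_limit_le[OF p(2) root_1])
    show "real (p_count n) \<le> 1 * b ^ n" for n
      using p_count_le_b_count[of n] b(3)[of n] by linarith
  qed (use b(1) in simp)
  moreover have "d \<le> b"
  proof (rule root_limit_le[OF d(2) root_1])
    show "real (d_count n) \<le> 1 * b ^ n" for n
      using d_count_le_b_count[of n] b(3)[of n] by linarith
  qed (use b(1) in simp)
  moreover have "b \<le> d"
  \<comment> \<open>The index shift by 2 costs only the constant factor
    \<open>d ^ 2\<close>.\<close>
  proof (rule root_limit_le[OF b(2) LIMSEQ_root_const])
    show "d ^ 2 > 0" "d \<ge> 0" using d(1) by simp_all
    fix n
    have "real (b_count n) \<le> real (d_count (n + 2))" using b_count_le_d_count by simp
    also have "\<dots> \<le> d ^ 2 * d ^ n" using d(3)[of "n + 2"] by (simp add: power2_eq_square ac_simps)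
    finally show "real (b_count n) \<le> d ^ 2 * d ^ n" .
  qed
  moreover have "b \<le> p"
  proof (rule root_limit_le[OF b(2) root_const_mult_limit[of 5]])
    fix n :: nat assume n: "n \<ge> 1"
    let ?c = "real (card (walks (big_walk_to 0) (2 * (2 * n))))"
    \<comment> \<open>With \<open>n\<close> fixed and \<open>m\<close> growing, the border costs the
      factor \<open>p ^ (8 * n)\<close>, constant in \<open>m\<close>, which the power trick
      removes.\<close>
    have "?c \<le> p ^ (2 * n)"
    proof (rule le_of_power_le_const_mult[where c = "p ^ (8 * n)"])
      fix m :: nat assume "m \<ge> 1"
      then have "?c ^ m \<le> real (p_count (m * (2 * n) + 4 * (2 * n)))"
        using card_big_walk_to_0_power_le[of m "2 * n"] n by (simp flip: of_nat_power)
      also have "\<dots> \<le> p ^ (m * (2 * n) + 4 * (2 * n))" by (rule p(3))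
      also have "\<dots> = p ^ (8 * n) * (p ^ (2 * n)) ^ m"
        by (simp add: algebra_simps flip: power_add power_mult)
      finally show "?c ^ m \<le> p ^ (8 * n) * (p ^ (2 * n)) ^ m" .
    qed (use p(1) in simp)
    have "(real (b_count n))\<^sup>2 \<le> (real (4 * n + 1))\<^sup>2 * ?c"
      using b_count_square_le[of n] by (simp flip: of_nat_power of_nat_mult del: of_nat_add of_nat_Suc)
    \<comment> \<open>For \<open>n \<ge> 1\<close>, \<open>4 * n + 1\<close> is at most
      \<open>5 * n\<close>, a factor whose \<open>n\<close>-th root tends to 1.\<close>
    also have "\<dots> \<le> (5 * real n)\<^sup>2 * p ^ (2 * n)"
      using n \<open>?c \<le> p ^ (2 * n)\<close> by (intro mult_mono power_mono) auto
    also have "\<dots> = (5 * real n * p ^ n)\<^sup>2" by (simp add: power_mult_distrib power_mult mult.commute)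
    finally show "real (b_count n) \<le> 5 * real n * p ^ n"
      by (rule power2_le_imp_le) (use p(1) in simp)
  qed (use p(1) in simp_all)
  ultimately have "p = b" "d = b" by simp_all
  then show ?thesis using p(2) d(2) b(2) by blast
qed

end
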